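(* Let $X$ be an $f$-block gluing $\mathbb{Z}^2$-subshift of finite type, where $f:\mathbb{N}\to\mathbb{N}$ is a non-decreasing function such that $f(n)\in o(\log n)$ and $f\le \mathrm{id}$ (i.e. $f(n)\le n$ for all $n$). Then the set of periodic points of $X$ is dense in $X$.
   Context: Let $\mathcal{A}$ be a finite alphabet; $\mathcal{A}^{\mathbb{Z}^2}$ carries the product of the discrete topologies, and the shift is $(\sigma^{u}x)_{v}=x_{u+v}$ for $u,v\in\mathbb{Z}^2$. A $\mathbb{Z}^2$-subshift is a compact subset $X\subset\mathcal{A}^{\mathbb{Z}^2}$ with $\sigma^{u}X\subset X$ for all $u\in\mathbb{Z}^2$. It is of finite type (SFT) if it is the set of configurations in which no translate of a pattern from some fixed finite set of patterns on finite supports appears. A configuration $x$ is periodic if there exist $m,n>0$ with $\sigma^{(m,0)}(x)=\sigma^{(0,n)}(x)=x$. An $n$-block is an element of $\mathcal{A}^{\{0,\dots,n-1\}^2}$; it is in the language of $X$ if it appears in a configuration of $X$. For $n$-blocks $p,q$ in the language of $X$, $$\Delta_X(p,q)=\{u\in\mathbb{Z}^2:\ \exists x\in X,\ x_{\{0,\dots,n-1\}^2}=q\ \text{and}\ x_{u+\{0,\dots,n-1\}^2}=p\}.$$ $X$ is $f$-block gluing if for every $n$ and all $n$-blocks $p,q$ in the language of $X$, every $u\in\mathbb{Z}^2$ with $\|u\|_\infty\ge n+f(n)$ belongs to $\Delta_X(p,q)$. *)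

theory Defs
  imports "HOL-Analysis.Analysis" "HOL-Library.Landau_Symbols"
begin

type_synonym 'a config = "int \<times> int \<Rightarrow> 'a"

definition config_topology :: "'a config topology" where
  "config_topology = product_topology (\<lambda>_. discrete_topology UNIV) UNIV"

definition shift :: "int \<times> int \<Rightarrow> 'a config \<Rightarrow> 'a config" where
  "shift u x = (\<lambda>v. x (u + v))"

definition subshift :: "'a config set \<Rightarrow> bool" where
  "subshift X \<longleftrightarrow> compactin config_topology X \<and> (\<forall>u. shift u ` X \<subseteq> X)"

text \<open>A pattern is a partial map on the plane, with its support as domain. Its translate
  by \<open>u\<close> appears in \<open>x\<close> iff the pattern agrees with \<open>shift u x\<close> on the support.\<close>

definition appears_at :: "(int \<times> int \<rightharpoonup> 'a) \<Rightarrow> int \<times> int \<Rightarrow> 'a config \<Rightarrow> bool" where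
  "appears_at p u x \<longleftrightarrow> p \<subseteq>\<^sub>m (\<lambda>v. Some (shift u x v))"

definition finite_type :: "'a config set \<Rightarrow> bool" where
  "finite_type X \<longleftrightarrow>
     (\<exists>F. finite F \<and> (\<forall>p\<in>F. finite (dom p)) \<and> X = {x. \<forall>p\<in>F. \<forall>u. \<not> appears_at p u x})"

definition periodic :: "'a config \<Rightarrow> bool" where
  "periodic x \<longleftrightarrow> (\<exists>m n. m > 0 \<and> n > 0 \<and> shift (m, 0) x = x \<and> shift (0, n) x = x)"

definition square :: "nat \<Rightarrow> (int \<times> int) set" where
  "square n = {0..<int n} \<times> {0..<int n}"

text \<open>Blocks are extensional functions on the square. A window of \<open>x\<close> at position \<open>u\<close>
  is identified with a block by translating it back to the origin.\<close>

definition blocks :: "nat \<Rightarrow> 'a config set" where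
  "blocks n = square n \<rightarrow>\<^sub>E UNIV"

definition window :: "nat \<Rightarrow> int \<times> int \<Rightarrow> 'a config \<Rightarrow> 'a config" where
  "window n u x = restrict (shift u x) (square n)"

definition language :: "'a config set \<Rightarrow> nat \<Rightarrow> 'a config set" where
  "language X n = {p \<in> blocks n. \<exists>x\<in>X. \<exists>u. window n u x = p}"

definition gluing_set :: "'a config set \<Rightarrow> nat \<Rightarrow> 'a config \<Rightarrow> 'a config \<Rightarrow> (int \<times> int) set" where
  "gluing_set X n p q = {u. \<exists>x\<in>X. window n 0 x = q \<and> window n u x = p}"

definition sup_norm :: "int \<times> int \<Rightarrow> int" where
  "sup_norm u = max \<bar>fst u\<bar> \<bar>snd u\<bar>"

definition block_gluing :: "(nat \<Rightarrow> nat) \<Rightarrow> 'a config set \<Rightarrow> bool" where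
  "block_gluing f X \<longleftrightarrow>
     (\<forall>n. \<forall>p\<in>language X n. \<forall>q\<in>language X n. \<forall>u.
        sup_norm u \<ge> int (n + f n) \<longrightarrow> u \<in> gluing_set X n p q)"

end

theory Submission
  imports Defs "HOL-Real_Asymp.Real_Asymp"
begin

text \<open>Fix a window size \<open>w\<close> that exceeds the forbidden patterns, and a \<open>w\<close>-block \<open>P\<close> of \<open>X\<close>.
  Gluing a block to a copy of itself \<open>k\<close> times in the horizontal direction gives a point of \<open>X\<close> with
  \<open>2 ^ k\<close> copies of \<open>P\<close> on one row, within a width \<open>n = 3 ^ k * w\<close>; here \<open>f n \<le> n\<close> is used.
  Gluing this block vertically to an overlapping window of the same point gives a strip of width \<open>n\<close>
  that can be repeated with the vertical period \<open>H = w + f n\<close>. Since \<open>f n\<close> is \<open>o(k)\<close>, there are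
  fewer than \<open>2 ^ k\<close> patterns on a \<open>w\<close> by \<open>H\<close> rectangle, so two of the copies of \<open>P\<close> extend to the
  same such rectangle. The part of the strip between them tiles the plane, and every
  \<open>w\<close>-window of this tiling occurs in \<open>X\<close>.\<close>

section \<open>Shifts, windows and the locality of finite type\<close>

lemma shift_apply [simp]: "shift u x v = x (u + v)"
  by (simp add: shift_def)

lemma shift_shift: "shift u (shift v x) = shift (u + v) x"
  by (simp add: shift_def ac_simps)

lemma subshift_shift: "subshift X \<Longrightarrow> x \<in> X \<Longrightarrow> shift u x \<in> X"
  unfolding subshift_def by blast

lemma periodic_shift: "periodic x \<Longrightarrow> periodic (shift u x)"
  unfolding periodic_def by (metis shift_shift add.commute)

lemma window_in_language: "x \<in> X \<Longrightarrow> window n u x \<in> language X n"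
  unfolding language_def by (auto simp: blocks_def window_def simp del: split_paired_Ex)

lemma window_eq_iff:
  "window n u x = window n v y \<longleftrightarrow>
     (\<forall>a b. 0 \<le> a \<longrightarrow> a < int n \<longrightarrow> 0 \<le> b \<longrightarrow> b < int n \<longrightarrow> x (u + (a, b)) = y (v + (a, b)))"
proof
  assume eq: "window n u x = window n v y"
  show "\<forall>a b. 0 \<le> a \<longrightarrow> a < int n \<longrightarrow> 0 \<le> b \<longrightarrow> b < int n \<longrightarrow> x (u + (a, b)) = y (v + (a, b))"
  proof (intro allI impI)
    fix a b assume "0 \<le> a" "a < int n" "0 \<le> b" "b < int n"
    then show "x (u + (a, b)) = y (v + (a, b))"
      using fun_cong[OF eq, of "(a, b)"] by (simp add: window_def square_def)
  qed
qed (auto simp: window_def square_def restrict_def)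

lemma glue:
  assumes "block_gluing f X" "x \<in> X" "y \<in> X" "sup_norm d \<ge> int (n + f n)"
  obtains z where "z \<in> X" "window n 0 z = window n u x" "window n d z = window n v y"
  using assms window_in_language[of x X n u] window_in_language[of y X n v]
  unfolding block_gluing_def gluing_set_def by blast

lemma finite_int_pairs_bounded:
  assumes "finite (A :: (int \<times> int) set)"
  shows "\<exists>m::nat. \<forall>a b. (a, b) \<in> A \<longrightarrow>
    -int m \<le> a \<and> a < int m \<and> -int m \<le> b \<and> b < int m"
proof -
  have "finite ((\<lambda>v. nat (sup_norm v)) ` A)" using assms by simp
  then obtain m where "\<And>v. v \<in> A \<Longrightarrow> nat (sup_norm v) < m"
    unfolding finite_nat_set_iff_bounded by auto
  then have "-int m \<le> a \<and> a < int m \<and> -int m \<le> b \<and> b < int m" if "(a, b) \<in> A" for a b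
    using that[THEN \<open>\<And>v. v \<in> A \<Longrightarrow> nat (sup_norm v) < m\<close>] by (auto simp: sup_norm_def)
  then show ?thesis by blast
qed

text \<open>A forbidden pattern whose support fits into a \<open>w\<close>-square would already be
  visible in a single \<open>w\<close>-window, hence in the point of \<open>X\<close> that shares
  this window.\<close>

lemma finite_type_local:
  assumes "finite_type X"
  obtains w0 where "\<And>w z. w \<ge> w0 \<Longrightarrow> (\<And>u. \<exists>y\<in>X. \<exists>v. window w u z = window w v y) \<Longrightarrow> z \<in> X"
proof -
  obtain F where F: "finite F" "\<And>p. p \<in> F \<Longrightarrow> finite (dom p)"
    and X: "X = {x. \<forall>p\<in>F. \<forall>u. \<not> appears_at p u x}"
    using assms unfolding finite_type_def by blast
  have "finite (\<Union>p\<in>F. dom p)" using F by simp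
  from finite_int_pairs_bounded[OF this]
  obtain m where *: "\<forall>a b. (a, b) \<in> (\<Union>p\<in>F. dom p) \<longrightarrow>
      -int m \<le> a \<and> a < int m \<and> -int m \<le> b \<and> b < int m" ..
  have m: "-int m \<le> a \<and> a < int m \<and> -int m \<le> b \<and> b < int m" if "p \<in> F" "(a, b) \<in> dom p" for p a b
    using *[rule_format, OF UN_I, OF that] .
  show ?thesis
  \<comment> \<open>All supports lie in the half-open box from \<open>-m\<close> to
    \<open>m\<close>, which is the \<open>2 * m\<close>-square moved by \<open>(-m, -m)\<close>.
    This is why the window is read at \<open>u - (m, m)\<close>.\<close>
  proof (rule that[of "2 * m"])
    fix w and z :: "'a config"
    assume w: "w \<ge> 2 * m" and loc: "\<And>u. \<exists>y\<in>X. \<exists>v. window w u z = window w v y"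
    have "\<not> appears_at p u z" if p: "p \<in> F" for p u
    proof
      assume ap: "appears_at p u z"
      obtain y v where y: "y \<in> X" and eq: "window w (u - (int m, int m)) z = window w v y"
        using loc by blast
      have "appears_at p (v + (int m, int m)) y"
        unfolding appears_at_def map_le_def
      proof
        fix c assume c: "c \<in> dom p"
        obtain a b where ab: "c = (a, b)" by fastforce
        have "z (u - (int m, int m) + (a + int m, b + int m)) = y (v + (a + int m, b + int m))"
          using eq m[OF p c[unfolded ab]] w unfolding window_eq_iff by simp
        then have "z (u + c) = y (v + (int m, int m) + c)"
          unfolding ab by (cases u; cases v) (simp add: algebra_simps)
        then show "p c = Some (shift (v + (int m, int m)) y c)"
          using ap c unfolding appears_at_def map_le_def by simp
      qed
      then show False using y p unfolding X by blast
    qed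
    then show "z \<in> X" unfolding X by blast
  qed
qed

section \<open>Gluing constructions\<close>

lemma many_copies_on_row:
  assumes gl: "block_gluing f X" and le: "\<And>n. f n \<le> n" and x: "x \<in> X" and "w > 0"
  shows "\<exists>y\<in>X. \<exists>S. finite S \<and> card S = 2 ^ k \<and>
    (\<forall>s\<in>S. 0 \<le> s \<and> s + int w \<le> int (3 ^ k * w) \<and> window w (s, 0) y = window w 0 x)"
proof (induction k)
  case 0
  show ?case
    by (rule bexI[OF _ x], rule exI[of _ "{0}"]) (simp add: zero_prod_def)
next
  case (Suc k)
  define n where "n = 3 ^ k * w"
  obtain y S where y: "y \<in> X" and S: "finite S" "card S = 2 ^ k"
    and yS: "\<And>s. s \<in> S \<Longrightarrow> 0 \<le> s \<and> s + int w \<le> int n \<and> window w (s, 0) y = window w 0 x"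
    using Suc unfolding n_def by blast
  \<comment> \<open>Since \<open>f n \<le> n\<close>, the distance \<open>2 * n\<close> is
    admissible. The new block has width \<open>3 * n\<close> whatever \<open>f\<close> is, so each
    step doubles the copies and triples the width.\<close>
  have "sup_norm (2 * int n, 0) \<ge> int (n + f n)"
    using le[of n] by (simp add: sup_norm_def)
  then obtain z where z: "z \<in> X" and z1: "window n 0 z = window n 0 y"
    and z2: "window n (2 * int n, 0) z = window n 0 y"
    using glue[OF gl y y] by metis
  define T where "T = S \<union> (\<lambda>s. s + 2 * int n) ` S"
  have "s \<noteq> s' + 2 * int n" if "s \<in> S" "s' \<in> S" for s s'
    using yS[OF that(1)] yS[OF that(2)] \<open>w > 0\<close> by linarith
  then have "S \<inter> (\<lambda>s. s + 2 * int n) ` S = {}" by blast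
  then have "card T = 2 ^ Suc k"
    unfolding T_def using S by (simp add: card_Un_disjoint card_image)
  moreover have "0 \<le> t \<and> t + int w \<le> int (3 ^ Suc k * w) \<and> window w (t, 0) z = window w 0 x"
    if t: "t \<in> T" for t
  proof -
    have n3: "int (3 ^ Suc k * w) = 3 * int n" by (simp add: n_def)
    obtain s where s: "s \<in> S" "t = s \<or> t = s + 2 * int n"
      using t unfolding T_def by blast
    note ys = yS[OF s(1)]
    have "window w (t, 0) z = window w (s, 0) y"
      unfolding window_eq_iff
    proof (intro allI impI)
      fix a b assume ab: "0 \<le> a" "a < int w" "0 \<le> b" "b < int w"
      have sab: "0 \<le> s + a" "s + a < int n" "b < int n" using ys ab by linarith+
      show "z ((t, 0) + (a, b)) = y ((s, 0) + (a, b))"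
        using s(2)
      proof
        assume "t = s"
        then show ?thesis
          using z1[unfolded window_eq_iff, rule_format, of "s + a" b] sab ab
          by (simp add: zero_prod_def)
      next
        assume "t = s + 2 * int n"
        then show ?thesis
          using z2[unfolded window_eq_iff, rule_format, of "s + a" b] sab ab
          by (simp add: zero_prod_def algebra_simps)
      qed
    qed
    then show ?thesis using ys s(2) n3 by auto
  qed
  moreover have "finite T" using S unfolding T_def by simp
  ultimately show ?case using z by blast
qed

text \<open>The glued windows of \<open>x\<close> are those at heights \<open>w - n\<close> and \<open>0\<close>: they share the rows
  between \<open>0\<close> and \<open>w\<close>.\<close>

lemma vertical_repetition:
  assumes sub: "subshift X" and gl: "block_gluing f X" and x: "x \<in> X" and "w \<le> n"
  obtains y where "y \<in> X"
    and "\<And>i j. \<lbrakk>0 \<le> i; i < int n; 0 \<le> j; j < int w\<rbrakk> \<Longrightarrow> y (i, j) = x (i, j)"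
    and "\<And>i j. \<lbrakk>0 \<le> i; i < int n; 0 \<le> j; j < int w\<rbrakk> \<Longrightarrow> y (i, j + int (w + f n)) = y (i, j)"
proof -
  have "sup_norm (0, int (n + f n)) \<ge> int (n + f n)"
    by (simp add: sup_norm_def)
  then obtain z where z: "z \<in> X" and z1: "window n 0 z = window n (0, int w - int n) x"
    and z2: "window n (0, int (n + f n)) z = window n 0 x"
    using glue[OF gl x x] by metis
  \<comment> \<open>In \<open>z\<close>, rows \<open>0\<close> to \<open>w - 1\<close> of
    \<open>x\<close> occur at height \<open>n - w\<close> from the lower window and at height
    \<open>n + f n\<close> from the upper one. The difference is the period
    \<open>w + f n\<close>.\<close>
  define y where "y = shift (0, int n - int w) z"
  have y1: "y (i, j) = x (i, j)" if "0 \<le> i" "i < int n" "0 \<le> j" "j < int w" for i j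
    using z1[unfolded window_eq_iff, rule_format, of i "int n - int w + j"] that \<open>w \<le> n\<close>
    by (simp add: y_def zero_prod_def)
  have y2: "y (i, j + int (w + f n)) = y (i, j)"
    if "0 \<le> i" "i < int n" "0 \<le> j" "j < int w" for i j
    using z2[unfolded window_eq_iff, rule_format, of i j] that \<open>w \<le> n\<close> y1[OF that]
    by (simp add: y_def zero_prod_def algebra_simps)
  show ?thesis
    using that[of y] subshift_shift[OF sub z] y1 y2 unfolding y_def by blast
qed

section \<open>Periods and counting\<close>

lemma eq_mod_period:
  fixes g :: "int \<Rightarrow> 'b"
  assumes "d > 0" and per: "\<And>k. 0 \<le> k \<Longrightarrow> k < w \<Longrightarrow> g (k + d) = g k"
    and "0 \<le> k" "k < d + w"
  shows "g k = g (k mod d)"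
  using assms(3,4)
proof (induction "nat k" arbitrary: k rule: less_induct)
  case less
  show ?case
  proof (cases "k < d")
    case True
    then show ?thesis using less.prems by simp
  next
    case False
    \<comment> \<open>One subtraction of \<open>d\<close> may not reach the range below
      \<open>d\<close>: when two copies of the block overlap, \<open>d\<close> is smaller than
      \<open>w\<close>.\<close>
    then have "g (k - d) = g ((k - d) mod d)"
      using less.prems \<open>d > 0\<close> by (intro less.hyps) auto
    moreover have "g k = g (k - d)"
      using per[of "k - d"] False less.prems by simp
    ultimately show ?thesis by simp
  qed
qed

text \<open>For \<open>n = 3 ^ k * w\<close>, \<open>ln n\<close> is linear in \<open>k\<close>, so
  \<open>f n\<close> is \<open>o(k)\<close>. The logarithm of the left side is then
  \<open>o(k)\<close> too, eventually at most \<open>k / 2\<close>, and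
  \<open>1/2 < ln 2\<close>.\<close>

lemma power_dominates_small_exponent:
  fixes f :: "nat \<Rightarrow> nat"
  assumes f: "(\<lambda>n. real (f n)) \<in> o(\<lambda>n. ln (real n))" and "w > 0" "C > 0"
  obtains k where "C ^ (w * (w + f (3 ^ k * w))) < (2::nat) ^ k"
proof -
  have lim: "filterlim (\<lambda>k. 3 ^ k * w) at_top (at_top :: nat filter)"
  proof (rule filterlim_at_top_mono[OF filterlim_ident])
    show "\<forall>\<^sub>F k in at_top. k \<le> 3 ^ k * w"
    proof (intro always_eventually allI)
      fix k :: nat
      have "k \<le> 3 ^ k" by (simp add: less_imp_le)
      also have "\<dots> \<le> 3 ^ k * w" using \<open>w > 0\<close> by simp
      finally show "k \<le> 3 ^ k * w" .
    qed
  qed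
  have "(\<lambda>k. real (f (3 ^ k * w))) \<in> o(\<lambda>k. ln (real (3 ^ k * w)))"
    using landau_o.small.compose[OF f lim] .
  also have "(\<lambda>k. ln (real (3 ^ k * w))) \<in> O(\<lambda>k. real k)"
  proof -
    have "real w > 0" using \<open>w > 0\<close> by simp
    then have "(\<lambda>k. ln (3 ^ k * real w)) \<in> O(\<lambda>k::nat. real k)"
      by real_asymp
    then show ?thesis by simp
  qed
  finally have fo: "(\<lambda>k. real (f (3 ^ k * w))) \<in> o(\<lambda>k. real k)" .
  have "(\<lambda>k. real w) \<in> o(\<lambda>k::nat. real k)" by real_asymp
  then have "(\<lambda>k. real w + real (f (3 ^ k * w))) \<in> o(\<lambda>k. real k)"
    using fo by (rule sum_in_smallo)
  moreover have "(\<lambda>_. real w * ln (real C)) \<in> O(\<lambda>_::nat. 1)" by simp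
  ultimately have "(\<lambda>k. real w * ln (real C) * (real w + real (f (3 ^ k * w)))) \<in> o(\<lambda>k. real k)"
    using landau_o.big_small_mult by fastforce
  then have "\<forall>\<^sub>F k in sequentially.
      norm (real w * ln (real C) * (real w + real (f (3 ^ k * w)))) \<le> (1/2) * norm (real k)"
    by (rule landau_o.smallD) simp
  \<comment> \<open>Positivity of \<open>k\<close> makes the comparison of \<open>k / 2\<close> with
    \<open>k * ln 2\<close> strict.\<close>
  then have "\<forall>\<^sub>F k in sequentially. k > 0 \<and>
      norm (real w * ln (real C) * (real w + real (f (3 ^ k * w)))) \<le> (1/2) * norm (real k)"
    by (intro eventually_conj eventually_gt_at_top)
  from eventually_happens'[OF sequentially_bot this]
  obtain k where k: "k > 0"
    "norm (real w * ln (real C) * (real w + real (f (3 ^ k * w)))) \<le> (1/2) * norm (real k)"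
    by blast
  have "ln (real C ^ (w * (w + f (3 ^ k * w)))) = real w * ln (real C) * (real w + real (f (3 ^ k * w)))"
    using \<open>C > 0\<close> by (simp add: ln_realpow)
  also have "\<dots> \<le> (1/2) * real k" using k(2) by simp
  also have "\<dots> < ln 2 * real k"
    using k(1) ln2_ge_two_thirds by (intro mult_strict_right_mono) auto
  also have "\<dots> = ln (2 ^ k)" by (simp add: ln_realpow)
  finally have "real C ^ (w * (w + f (3 ^ k * w))) < 2 ^ k"
    using \<open>C > 0\<close> by simp
  then have "real (C ^ (w * (w + f (3 ^ k * w)))) < real (2 ^ k)" by simp
  then show ?thesis by (intro that) (simp only: of_nat_less_iff)
qed

section \<open>The periodic tiling\<close>

lemma periodic_point_with_window:
  fixes X :: "('a::finite) config set"
  assumes sub: "subshift X" and gl: "block_gluing f X"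
    and f: "(\<lambda>n. real (f n)) \<in> o(\<lambda>n. ln (real n))" and le: "\<And>n. f n \<le> n"
    and x: "x \<in> X" and w: "w > 0"
    and loc: "\<And>z. (\<And>u. \<exists>y\<in>X. \<exists>v. window w u z = window w v y) \<Longrightarrow> z \<in> X"
  obtains z where "z \<in> X" "periodic z" "window w 0 z = window w 0 x"
proof -
  have "CARD('a) > 0" by simp
  then obtain k where k: "CARD('a) ^ (w * (w + f (3 ^ k * w))) < (2::nat) ^ k"
    using power_dominates_small_exponent[OF f w] by metis
  define n where "n = 3 ^ k * w"
  define H where "H = w + f n"
  have wn: "w \<le> n" unfolding n_def by simp
  have H: "H > 0" "w \<le> H" using w unfolding H_def by auto
  obtain x' S where x': "x' \<in> X" and S: "finite S" "card S = 2 ^ k"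
    and xS: "\<And>s. s \<in> S \<Longrightarrow> 0 \<le> s \<and> s + int w \<le> int n \<and> window w (s, 0) x' = window w 0 x"
    using many_copies_on_row[OF gl le x w, of k] unfolding n_def by blast
  obtain y where y: "y \<in> X"
    and y1: "\<And>i j. \<lbrakk>0 \<le> i; i < int n; 0 \<le> j; j < int w\<rbrakk> \<Longrightarrow> y (i, j) = x' (i, j)"
    and y2: "\<And>i j. \<lbrakk>0 \<le> i; i < int n; 0 \<le> j; j < int w\<rbrakk> \<Longrightarrow> y (i, j + int H) = y (i, j)"
    using vertical_repetition[OF sub gl x' wn] unfolding H_def by metis
  \<comment> \<open>The height is one full vertical period. Agreement on \<open>w\<close> columns is
    what lets a \<open>w\<close>-window cross the seam between two horizontal tiles.\<close>
  define R where "R = {0..<int w} \<times> {0..<int H}"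
  define st where "st s = restrict (shift (s, 0) y) R" for s
  have fin: "finite (R \<rightarrow>\<^sub>E (UNIV :: 'a set))"
    unfolding R_def by (intro finite_PiE) auto
  have "card (st ` S) \<le> card (R \<rightarrow>\<^sub>E (UNIV :: 'a set))"
    by (rule card_mono[OF fin]) (auto simp: st_def)
  also have "\<dots> = CARD('a) ^ (w * H)"
    unfolding R_def by (subst card_PiE) (auto simp: card_cartesian_product)
  also have "\<dots> < card S" using k S unfolding H_def n_def by simp
  finally have "\<not> inj_on st S" by (rule pigeonhole)
  then obtain s t where st: "s \<in> S" "t \<in> S" "s < t" "st s = st t"
    unfolding inj_on_def by (metis linorder_less_linear)
  define d where "d = t - s"
  have d: "d > 0" using st by (simp add: d_def)
  note xs = xS[OF st(1)] and xt = xS[OF st(2)]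
  have hor: "y (s + a, b) = y (s + a mod d, b)"
    if "0 \<le> a" "a < d + int w" "0 \<le> b" "b < int H" for a b
  proof (rule eq_mod_period[where g = "\<lambda>a. y (s + a, b)", OF d])
    fix c assume "0 \<le> c" "c < int w"
    then show "y (s + (c + d), b) = y (s + c, b)"
      using fun_cong[OF st(4), of "(c, b)"] that by (simp add: st_def R_def d_def algebra_simps)
  qed (use that in auto)
  have ver: "y (i, b) = y (i, b mod int H)"
    if "0 \<le> i" "i < int n" "0 \<le> b" "b < int H + int w" for i b
    by (rule eq_mod_period[where g = "\<lambda>b. y (i, b)" and w = "int w"]) (use y2 H that in auto)
  define z where "z = (\<lambda>(i, j). y (s + i mod d, j mod int H))"
  \<comment> \<open>A window starting inside a tile leaves it by fewer than \<open>w\<close> columns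
    or rows, and there \<open>y\<close> itself repeats the tile.\<close>
  have win: "window w (i, j) z = window w (s + i mod d, j mod int H) y" for i j
    unfolding window_eq_iff
  proof (intro allI impI)
    fix a b assume ab: "0 \<le> a" "a < int w" "0 \<le> b" "b < int w"
    define i' where "i' = i mod d + a"
    define j' where "j' = j mod int H + b"
    have i': "0 \<le> i'" "i' < d + int w" "i' mod d = (i + a) mod d"
      using d ab pos_mod_bound[of d i] pos_mod_sign[of d i] unfolding i'_def
      by (auto simp: mod_simps intro: add_less_le_mono add_strict_mono)
    have j': "0 \<le> j'" "j' < int H + int w" "j' mod int H = (j + b) mod int H"
      using H ab pos_mod_bound[of "int H" j] pos_mod_sign[of "int H" j] unfolding j'_def
      by (auto simp: mod_simps intro: add_less_le_mono add_strict_mono)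
    \<comment> \<open>The height is reduced first, because \<open>hor\<close> holds only below
      \<open>H\<close>. The column stays inside the strip, as
      \<open>s + i' < t + w \<le> n\<close>.\<close>
    have "y (s + i', j') = y (s + i', j' mod int H)"
      using i' j' xs xt by (intro ver) (auto simp: d_def)
    also have "\<dots> = y (s + i' mod d, j' mod int H)"
      using i' H by (intro hor) auto
    finally show "z ((i, j) + (a, b)) = y ((s + i mod d, j mod int H) + (a, b))"
      using i' j' by (simp add: z_def i'_def j'_def add.assoc)
  qed
  have "z \<in> X"
  proof (rule loc)
    fix u :: "int \<times> int"
    show "\<exists>y\<in>X. \<exists>v. window w u z = window w v y"
      using win y by (cases u) blast
  qed
  moreover have "periodic z"
    unfolding periodic_def
    by (rule exI[of _ d], rule exI[of _ "int H"]) (use d H in \<open>auto simp: z_def shift_def fun_eq_iff\<close>)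
  moreover have "window w 0 z = window w (s, 0) x'"
  proof -
    have "window w 0 z = window w (s, 0) y"
      using win[of 0 0] by (simp add: zero_prod_def)
    also have "\<dots> = window w (s, 0) x'"
      unfolding window_eq_iff using xs y1 by simp
    finally show ?thesis .
  qed
  ultimately show ?thesis using that xs by metis
qed

section \<open>Density\<close>

theorem proposition23:
  fixes X :: "('a::finite) config set" and f :: "nat \<Rightarrow> nat"
  assumes "subshift X"
    and "finite_type X"
    and "block_gluing f X"
    and "mono f"
    and "(\<lambda>n. real (f n)) \<in> o(\<lambda>n. ln (real n))"
    and "\<And>n. f n \<le> n"
  shows "subtopology config_topology X closure_of {x \<in> X. periodic x} = X"
proof
  have top: "topspace (subtopology config_topology X) = X"
    by (simp add: config_topology_def)
  then show "subtopology config_topology X closure_of {x \<in> X. periodic x} \<subseteq> X"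
    using closure_of_subset_topspace by metis
  obtain w0 where loc: "\<And>w z. w \<ge> w0 \<Longrightarrow>
      (\<And>u. \<exists>y\<in>X. \<exists>v. window w u z = window w v y) \<Longrightarrow> z \<in> X"
    using finite_type_local[OF \<open>finite_type X\<close>] by blast
  show "X \<subseteq> subtopology config_topology X closure_of {x \<in> X. periodic x}"
    unfolding in_closure_of subset_iff top
  proof (intro allI impI conjI)
    fix x T assume x: "x \<in> X" and T: "x \<in> T \<and> openin (subtopology config_topology X) T"
    obtain U where U: "openin config_topology U" "T = U \<inter> X"
      using T by (auto simp: openin_subtopology)
    obtain V :: "int \<times> int \<Rightarrow> 'a set" where V: "finite {i. V i \<noteq> UNIV}" "x \<in> Pi\<^sub>E UNIV V" "Pi\<^sub>E UNIV V \<subseteq> U"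
      using U T unfolding config_topology_def openin_product_topology_alt by auto
    from finite_int_pairs_bounded[OF V(1)]
    obtain m where "\<forall>a b. (a, b) \<in> {i. V i \<noteq> UNIV} \<longrightarrow>
        -int m \<le> a \<and> a < int m \<and> -int m \<le> b \<and> b < int m" ..
    then have m: "-int m \<le> a \<and> a < int m \<and> -int m \<le> b \<and> b < int m" if "V (a, b) \<noteq> UNIV" for a b
      using that by blast
    \<comment> \<open>The square must hold the finitely many constrained coordinates, be large
      enough for \<open>loc\<close>, and be nonempty. The shift by \<open>c\<close> moves the box
      around the origin into this square.\<close>
    define w where "w = max (2 * m) (max w0 1)"
    define c where "c = (int m, int m)"
    have "w > 0" "w \<ge> w0" "2 * m \<le> w" by (auto simp: w_def)
    then obtain z where z: "z \<in> X" "periodic z" "window w 0 z = window w 0 (shift (- c) x)"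
      using periodic_point_with_window[OF assms(1,3,5,6) subshift_shift[OF assms(1) x], of w "- c"] loc
      by metis
    have "shift c z (a, b) = x (a, b)" if "V (a, b) \<noteq> UNIV" for a b
      using z(3)[unfolded window_eq_iff, rule_format, of "a + int m" "b + int m"] m[OF that] \<open>2 * m \<le> w\<close>
      by (simp add: c_def zero_prod_def add.commute)
    then have "shift c z \<in> Pi\<^sub>E UNIV V"
      using V(2) by (fastforce simp: PiE_UNIV_domain)
    then show "\<exists>y. y \<in> {x \<in> X. periodic x} \<and> y \<in> T"
      using U V(3) z(1,2) subshift_shift[OF assms(1)] periodic_shift by blast
  qed
qed

end
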